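(* Let $V$ be a countably infinite set. The Haar measure $\mu_{\rm Haar}$ on the compact abelian group $\mathscr{G}(V)$ (normalized to be a probability measure) is the product probability measure $\mu_{1/2}$ induced by the Bernoulli$(\tfrac12)$-measure on each factor $\{0,1\}$ of $\mathscr{G}(V) = \{0,1\}^{K_V}$. Moreover, given any bijection $\psi : K_V \to \mathbb{N}$, any $G \in \mathscr{G}(V)$ and any $\epsilon \in [0,1]$, both the open ball $\{G' \in \mathscr{G}(V) : \|G' \Delta G\|_{\psi,2} < \epsilon\}$ and the closed ball $\{G' \in \mathscr{G}(V) : \|G' \Delta G\|_{\psi,2} \le \epsilon\}$ have Haar measure equal to $\epsilon$.
   Context: For a set $V$ of labelled vertices, $K_V$ denotes the complete graph on $V$, identified with its edge set (the set of unordered pairs of distinct vertices). $\mathscr{G}(V)$ is the set of all graphs with vertex set $V$; each graph is identified with its edge set, so $\mathscr{G}(V) = \{0,1\}^{K_V} = (\mathbb{Z}/2\mathbb{Z})^{K_V}$ with the product topology, a compact Hausdorff abelian group under $G + G' := G \Delta G'$ (symmetric difference), with identity the empty graph $\mathbf{0}$. Measures are on the Borel $\sigma$-algebra of $\mathscr{G}(V)$. $\mathbb{N} = \{1,2,3,\dots\}$. For a bijection $\psi : K_V \to \mathbb{N}$, $\|G\|_{\psi,2} := \sum_{e \in G} 2^{-\psi(e)}$, and the associated metric is $(G,G') \mapsto \|G \Delta G'\|_{\psi,2}$. *)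

theory Defs
  imports "HOL-Probability.Probability" "HOL-Algebra.Group"
begin

section \<open>Compact abelian groups and Haar probability measures\<close>

definition compact_abelian_group :: "('a, 'b) monoid_scheme \<Rightarrow> 'a topology \<Rightarrow> bool" where
  "compact_abelian_group G T \<longleftrightarrow>
     comm_group G \<and> topspace T = carrier G \<and>
     continuous_map (prod_topology T T) T (\<lambda>(x, y). x \<otimes>\<^bsub>G\<^esub> y) \<and>
     continuous_map T T (\<lambda>x. inv\<^bsub>G\<^esub> x) \<and>
     compact_space T \<and> Hausdorff_space T"

text \<open>
  Haar measure in the usual sense: a regular (Radon) Borel measure that is invariant under
  translations, here normalized to total mass 1. Uniqueness is not part of the definition.
\<close>

definition haar_probability ::
    "('a, 'b) monoid_scheme \<Rightarrow> 'a topology \<Rightarrow> 'a measure \<Rightarrow> bool" where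
  "haar_probability G T M \<longleftrightarrow>
     sets M = sigma_sets (topspace T) {U. openin T U} \<and>
     prob_space M \<and>
     (\<forall>g\<in>carrier G. \<forall>A\<in>sets M. emeasure M ((\<lambda>x. g \<otimes>\<^bsub>G\<^esub> x) ` A) = emeasure M A) \<and>
     (\<forall>A\<in>sets M. emeasure M A = (INF U\<in>{U. openin T U \<and> A \<subseteq> U}. emeasure M U)) \<and>
     (\<forall>U. openin T U \<longrightarrow> emeasure M U = (SUP K\<in>{K. compactin T K \<and> K \<subseteq> U}. emeasure M K))"


section \<open>The space of graphs on a vertex set\<close>

definition complete_graph :: "'v set \<Rightarrow> 'v set set" where
  "complete_graph V = {{u, v} | u v. u \<in> V \<and> v \<in> V \<and> u \<noteq> v}"

definition graphs :: "'v set \<Rightarrow> 'v set set set" where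
  "graphs V = Pow (complete_graph V)"

text \<open>
  A graph is a set of edges. The two maps below are the mutually inverse identifications
  between edge sets and points of the product \<open>{0,1}\<^bsup>K\<^esup>\<close>, with \<^typ>\<open>bool\<close> as the
  two-point factor and extensional functions as in \<^const>\<open>product_topology\<close> and
  \<^const>\<open>PiM\<close>.
\<close>

definition graph_indicator :: "'v set \<Rightarrow> 'v set set \<Rightarrow> ('v set \<Rightarrow> bool)" where
  "graph_indicator V G = (\<lambda>e\<in>complete_graph V. e \<in> G)"

definition graph_of_indicator :: "'v set \<Rightarrow> ('v set \<Rightarrow> bool) \<Rightarrow> 'v set set" where
  "graph_of_indicator V f = {e \<in> complete_graph V. f e}"

definition graph_group :: "'v set \<Rightarrow> 'v set set monoid" where
  "graph_group V = \<lparr>carrier = graphs V, monoid.mult = sym_diff, one = {}\<rparr>"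

definition graph_topology :: "'v set \<Rightarrow> 'v set set topology" where
  "graph_topology V =
     pullback_topology (graphs V) (graph_indicator V)
       (product_topology (\<lambda>_. discrete_topology UNIV) (complete_graph V))"

definition graph_borel :: "'v set \<Rightarrow> 'v set set measure" where
  "graph_borel V = sigma (graphs V) {U. openin (graph_topology V) U}"

definition fair_graph_measure :: "'v set \<Rightarrow> 'v set set measure" where
  "fair_graph_measure V =
     distr (PiM (complete_graph V) (\<lambda>_. measure_pmf (bernoulli_pmf (1 / 2))))
       (graph_borel V) (graph_of_indicator V)"

definition graph_norm :: "('v set \<Rightarrow> nat) \<Rightarrow> 'v set set \<Rightarrow> real" where
  "graph_norm \<psi> G = (\<Sum>\<^sub>\<infinity>e\<in>G. 1 / 2 ^ \<psi> e)"

definition graph_open_ball ::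
    "'v set \<Rightarrow> ('v set \<Rightarrow> nat) \<Rightarrow> 'v set set \<Rightarrow> real \<Rightarrow> 'v set set set" where
  "graph_open_ball V \<psi> G \<epsilon> = {G' \<in> graphs V. graph_norm \<psi> (sym_diff G' G) < \<epsilon>}"

definition graph_closed_ball ::
    "'v set \<Rightarrow> ('v set \<Rightarrow> nat) \<Rightarrow> 'v set set \<Rightarrow> real \<Rightarrow> 'v set set set" where
  "graph_closed_ball V \<psi> G \<epsilon> = {G' \<in> graphs V. graph_norm \<psi> (sym_diff G' G) \<le> \<epsilon>}"


section \<open>The graph space is a compact abelian group\<close>

lemma graph_indicator_inverse:
  "G \<in> graphs V \<Longrightarrow> graph_of_indicator V (graph_indicator V G) = G"
  by (auto simp: graphs_def graph_of_indicator_def graph_indicator_def)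

lemma graph_of_indicator_inverse:
  "f \<in> extensional (complete_graph V) \<Longrightarrow> graph_indicator V (graph_of_indicator V f) = f"
  by (auto simp: graph_of_indicator_def graph_indicator_def extensional_def fun_eq_iff)

lemma topspace_graph_topology [simp]: "topspace (graph_topology V) = graphs V"
  by (auto simp: graph_topology_def topspace_pullback_topology graph_indicator_def)

lemma homeomorphic_maps_graph_topology:
  "homeomorphic_maps (graph_topology V)
     (product_topology (\<lambda>_. discrete_topology UNIV) (complete_graph V))
     (graph_indicator V) (graph_of_indicator V)"
  (is "homeomorphic_maps ?T ?P ?f ?g")
proof -
  have "continuous_map ?T ?P (id \<circ> ?f)"
    unfolding graph_topology_def by (intro continuous_map_pullback continuous_map_id)
  moreover have "continuous_map ?P ?T ?g"
    unfolding graph_topology_def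
  proof (rule continuous_map_pullback')
    have "continuous_map ?P ?P id" by simp
    then show "continuous_map ?P ?P (?f \<circ> ?g)"
      by (rule continuous_map_eq) (simp add: graph_of_indicator_inverse PiE_def)
  qed (auto simp: graphs_def graph_of_indicator_def)
  ultimately show ?thesis
    by (auto simp: homeomorphic_maps_def graph_indicator_inverse graph_of_indicator_inverse PiE_def)
qed

lemma sym_diff_in_graphs: "G \<in> graphs V \<Longrightarrow> H \<in> graphs V \<Longrightarrow> sym_diff G H \<in> graphs V"
  unfolding graphs_def by blast

lemma comm_group_graph_group: "comm_group (graph_group V)"
proof (rule comm_groupI)
  fix x assume x: "x \<in> carrier (graph_group V)"
  then have "x \<otimes>\<^bsub>graph_group V\<^esub> x = \<one>\<^bsub>graph_group V\<^esub>"
    by (simp add: graph_group_def)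
  with x show "\<exists>y\<in>carrier (graph_group V). y \<otimes>\<^bsub>graph_group V\<^esub> x = \<one>\<^bsub>graph_group V\<^esub>"
    by blast
qed (auto simp: graph_group_def graphs_def)

lemma inv_graph_group: "x \<in> graphs V \<Longrightarrow> inv\<^bsub>graph_group V\<^esub> x = x"
proof -
  interpret comm_group "graph_group V" by (rule comm_group_graph_group)
  assume "x \<in> graphs V"
  then show ?thesis
    by (intro inv_equality) (auto simp: graph_group_def)
qed

theorem compact_abelian_group_graph_group:
  "compact_abelian_group (graph_group V) (graph_topology V)"
proof -
  let ?K = "complete_graph V" and ?T = "graph_topology V"
  let ?P = "product_topology (\<lambda>_. discrete_topology (UNIV :: bool set)) ?K"
  have hom: "?T homeomorphic_space ?P"
    using homeomorphic_maps_graph_topology unfolding homeomorphic_space_def by blast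
  have coord: "continuous_map ?T (discrete_topology UNIV) (\<lambda>G. e \<in> G)" if "e \<in> ?K" for e
  proof -
    have "continuous_map ?T (discrete_topology UNIV) ((\<lambda>f. f e) \<circ> graph_indicator V)"
      unfolding graph_topology_def
      using that by (intro continuous_map_pullback continuous_map_product_projection)
    then show ?thesis
      using that by (simp add: graph_indicator_def o_def)
  qed
  have "continuous_map (prod_topology ?T ?T) ?T (\<lambda>(x, y). sym_diff x y)"
  proof (subst (3) graph_topology_def, rule continuous_map_pullback')
    show "continuous_map (prod_topology ?T ?T) ?P
            (graph_indicator V \<circ> (\<lambda>(x, y). sym_diff x y))"
      unfolding continuous_map_componentwise
    proof (intro conjI ballI)
      show "(graph_indicator V \<circ> (\<lambda>(x, y). sym_diff x y))
              ` topspace (prod_topology ?T ?T) \<subseteq> extensional ?K"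
        by (rule image_subsetI) (simp add: graph_indicator_def)
    next
      fix e assume e: "e \<in> ?K"
      let ?D = "discrete_topology (UNIV :: bool set)"
      have "continuous_map (prod_topology ?T ?T) (prod_topology ?D ?D)
              (\<lambda>p. (e \<in> fst p, e \<in> snd p))"
        unfolding continuous_map_paired
        using continuous_map_compose[OF continuous_map_fst coord[OF e], unfolded o_def]
          continuous_map_compose[OF continuous_map_snd coord[OF e], unfolded o_def]
        by (rule conjI)
      moreover have "continuous_map (prod_topology ?D ?D) ?D (\<lambda>(a, b). a \<noteq> b)"
        unfolding prod_topology_discrete_topology[symmetric] continuous_map_from_discrete_topology
        by simp
      ultimately have "continuous_map (prod_topology ?T ?T) ?D
          ((\<lambda>(a, b). a \<noteq> b) \<circ> (\<lambda>p. (e \<in> fst p, e \<in> snd p)))"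
        by (rule continuous_map_compose)
      then show "continuous_map (prod_topology ?T ?T) ?D
          (\<lambda>p. (graph_indicator V \<circ> (\<lambda>(x, y). sym_diff x y)) p e)"
        by (rule continuous_map_eq) (use e in \<open>auto simp: graph_indicator_def\<close>)
    qed
    show "topspace (prod_topology ?T ?T) \<subseteq> (\<lambda>(x, y). sym_diff x y) -` graphs V"
      unfolding topspace_prod_topology topspace_graph_topology
      by (rule subsetI, erule SigmaE) (simp only: vimage_eq prod.case sym_diff_in_graphs)
  qed
  moreover have "continuous_map ?T ?T (\<lambda>x. inv\<^bsub>graph_group V\<^esub> x)"
  proof -
    have "continuous_map ?T ?T id" by simp
    then show ?thesis
      by (rule continuous_map_eq) (simp add: inv_graph_group)
  qed
  moreover have "compact_space ?T"
    using homeomorphic_compact_space[OF hom]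
    by (simp add: compact_space_product_topology compact_space_discrete_topology)
  moreover have "Hausdorff_space ?T"
    using homeomorphic_Hausdorff_space[OF hom]
    by (simp add: Hausdorff_space_product_topology)
  ultimately show ?thesis
    using comm_group_graph_group
    by (simp add: compact_abelian_group_def graph_group_def)
qed

end

theory Submission
  imports Defs
begin

text \<open>
  The clopen cylinders \<open>{G. G \<inter> F \<in> S}\<close> with \<open>F\<close> finite generate the Borel sets, and a
  translation-invariant probability measure gives each of the \<open>2\<^bsup>card F\<^esup>\<close> atoms over \<open>F\<close> the same
  mass; so does the fair product measure, and the two agree by the \<open>\<pi>\<close>-system argument. The first
  \<open>n\<close> edges determine the norm up to \<open>2\<^bsup>-n\<^esup>\<close> and are binary digits, so a closed ball of radius \<open>\<epsilon>\<close>
  has measure at most \<open>\<epsilon> + 2\<^bsup>-n\<^esup>\<close>. An open ball is the complement of the closed ball of radius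
  \<open>1 - \<epsilon>\<close> around the complementary graph, which supplies the matching lower bound.
\<close>

section \<open>Regularity of finite measures generated by clopen sets\<close>

text \<open>Induction over the generated sigma-algebra: the sets that can be squeezed between a
  closed and an open set with arbitrarily small gap include the clopen generators and survive
  complements and countable unions.\<close>

lemma closed_open_approximation:
  assumes "finite_measure M"
    and sets: "sets M = sigma_sets (topspace T) B"
    and clopen: "\<And>b. b \<in> B \<Longrightarrow> openin T b \<and> closedin T b"
    and open_sets: "\<And>U. openin T U \<Longrightarrow> U \<in> sets M"
    and A: "A \<in> sets M" and e: "0 < (e::real)"
  shows "\<exists>C U. closedin T C \<and> openin T U \<and> C \<subseteq> A \<and> A \<subseteq> U \<and> measure M (U - C) < e"
proof -
  interpret finite_measure M by fact
  have B: "B \<subseteq> Pow (topspace T)" using clopen openin_subset by blast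
  have space: "space M = topspace T"
    using sets B by (metis sets_measure_of sets_eq_imp_space_eq space_measure_of)
  have closed_sets: "C \<in> sets M" if "closedin T C" for C
  proof -
    have "topspace T - (topspace T - C) = C" using that closedin_subset by blast
    moreover have "topspace T - C \<in> sets M" using that open_sets by blast
    ultimately show ?thesis using sets.compl_sets[of "topspace T - C" M] by (simp add: space)
  qed
  have "A \<in> sigma_sets (topspace T) B" using A sets by simp
  then show ?thesis using e
  proof (induction arbitrary: e)
    case (Basic b)
    then show ?case using clopen[of b] by (intro exI[of _ b]) auto
  next
    case Empty
    then show ?case by (intro exI[of _ "{}"]) auto
  next
    case (Compl a)
    obtain C U where CU: "closedin T C" "openin T U" "C \<subseteq> a" "a \<subseteq> U" "measure M (U - C) < e"
      using Compl.IH[OF Compl.prems] by (elim exE conjE)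
    \<comment> \<open>Complementation swaps the closed and the open set and leaves the gap
      unchanged.\<close>
    have "(topspace T - C) - (topspace T - U) = U - C"
      using CU(2) openin_subset by blast
    then show ?case
      using CU by (intro exI[of _ "topspace T - U"] exI[of _ "topspace T - C"]) auto
  next
    case (Union a)
    \<comment> \<open>These errors add up to \<open>e / 2\<close> rather than \<open>e\<close>:
      comparing series yields only a weak inequality, while the final gap must be strictly below
      \<open>e\<close>.\<close>
    define d where "d n = e / 2 / 2 ^ Suc n" for n :: nat
    have "\<exists>C U. closedin T C \<and> openin T U \<and> C \<subseteq> a n \<and> a n \<subseteq> U \<and> measure M (U - C) < d n" for n
      using Union.IH[of "d n"] Union.prems by (simp add: d_def)
    then obtain C U where
      CU: "\<And>n. closedin T (C n)" "\<And>n. openin T (U n)" "\<And>n. C n \<subseteq> a n" "\<And>n. a n \<subseteq> U n"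
        "\<And>n. measure M (U n - C n) < d n"
      by metis
    \<comment> \<open>An infinite union of closed sets may fail to be closed, so only finitely many
      \<open>C i\<close> are kept. The sets \<open>(\<Union>i. U i) - D n\<close> decrease to
      \<open>(\<Union>i. U i) - (\<Union>i. C i)\<close>, and continuity from above supplies a
      suitable \<open>n\<close>.\<close>
    define D where "D n = (\<Union>i<n. C i)" for n
    have sD: "D n \<in> sets M" for n using closed_sets[OF CU(1)] by (auto simp: D_def)
    have sU: "(\<Union>i. U i) \<in> sets M" using CU(2) open_sets by blast
    have d: "d sums (e / 2)"
    proof -
      have "(\<lambda>n. (e/2) * (1/2) ^ Suc n) sums ((e/2) * 1)"
        by (intro sums_mult power_half_series)
      then show ?thesis by (simp add: d_def[abs_def] power_one_over divide_simps)
    qed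
    have sm: "summable (\<lambda>n. measure M (U n - C n))"
      by (rule summable_comparison_test'[OF sums_summable[OF d], of 0]) (use CU(5) in \<open>auto intro: less_imp_le\<close>)
    have "measure M ((\<Union>i. U i) - (\<Union>i. C i)) \<le> measure M (\<Union>i. U i - C i)"
      using open_sets[OF CU(2)] closed_sets[OF CU(1)] by (intro finite_measure_mono) auto
    also have "\<dots> \<le> (\<Sum>i. measure M (U i - C i))"
      using open_sets[OF CU(2)] closed_sets[OF CU(1)] sm
      by (intro finite_measure_subadditive_countably) auto
    also have "\<dots> \<le> (\<Sum>i. d i)"
      using CU(5) sm sums_summable[OF d] by (intro suminf_le) (auto intro: less_imp_le)
    also have "\<dots> = e / 2" using d by (rule sums_unique[symmetric])
    finally have le: "measure M ((\<Union>i. U i) - (\<Union>i. C i)) \<le> e / 2" .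
    have lim: "(\<lambda>n. measure M ((\<Union>i. U i) - D n)) \<longlonglongrightarrow> measure M (\<Inter>n. (\<Union>i. U i) - D n)"
      using sD sU by (intro finite_Lim_measure_decseq) (force simp: decseq_def D_def)+
    have eq: "(\<Inter>n. (\<Union>i. U i) - D n) = (\<Union>i. U i) - (\<Union>i. C i)"
      by (auto simp: D_def)
    have less: "measure M ((\<Union>i. U i) - (\<Union>i. C i)) < e"
      using le Union.prems by simp
    have "\<forall>\<^sub>F n in sequentially. measure M ((\<Union>i. U i) - D n) < e"
      by (rule order_tendstoD(2)[OF lim[unfolded eq] less])
    then obtain n where "measure M ((\<Union>i. U i) - D n) < e"
      by (auto simp: eventually_sequentially)
    moreover have "closedin T (D n)"
      unfolding D_def using CU(1) by (intro closedin_Union) auto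
    moreover have "openin T (\<Union>i. U i)" using CU(2) by blast
    moreover have "D n \<subseteq> (\<Union>i. a i)" "(\<Union>i. a i) \<subseteq> (\<Union>i. U i)"
      unfolding D_def using CU(3) by blast (rule UN_mono[OF order_refl CU(4)])
    ultimately show ?case by blast
  qed
qed

text \<open>The open sets of the preceding approximation give outer regularity; its closed sets are
  compact because the space is, and give inner regularity.\<close>

lemma regular_if_generated_by_clopen:
  assumes "finite_measure M" "compact_space T"
    and "sets M = sigma_sets (topspace T) B"
    and "\<And>b. b \<in> B \<Longrightarrow> openin T b \<and> closedin T b"
    and open_sets: "\<And>U. openin T U \<Longrightarrow> U \<in> sets M"
    and A: "A \<in> sets M"
  shows outer_regular_if_generated_by_clopen:
      "emeasure M A = (INF U\<in>{U. openin T U \<and> A \<subseteq> U}. emeasure M U)"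
    and inner_regular_if_generated_by_clopen:
      "emeasure M A = (SUP K\<in>{K. compactin T K \<and> K \<subseteq> A}. emeasure M K)"
proof -
  interpret finite_measure M by fact
  have closed_sets: "C \<in> sets M" if "closedin T C" for C
  proof -
    have "topspace T - (topspace T - C) = C" using that closedin_subset by blast
    moreover have "topspace T - C \<in> sets M" "topspace T \<in> sets M" using that open_sets by blast+
    ultimately show ?thesis using sets.Diff by metis
  qed
  have approx: "\<exists>C U. closedin T C \<and> openin T U \<and> C \<subseteq> A \<and> A \<subseteq> U \<and>
      measure M U < measure M A + e \<and> measure M A < measure M C + e" if "0 < e" for e :: real
  proof -
    obtain C U where CU: "closedin T C" "openin T U" "C \<subseteq> A" "A \<subseteq> U" "measure M (U - C) < e"
      using closed_open_approximation[OF assms(1,3,4,5) A \<open>0 < e\<close>] by auto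
    have s: "C \<in> sets M" "U \<in> sets M" using CU closed_sets open_sets by auto
    \<comment> \<open>Since \<open>C \<subseteq> A \<subseteq> U\<close>, the one small gap
      \<open>U - C\<close> bounds the error on both sides of \<open>A\<close>.\<close>
    have "measure M U = measure M C + measure M (U - C)"
      using finite_measure_Diff[OF s(2,1)] CU(3,4) by auto
    moreover have "measure M C \<le> measure M A" "measure M A \<le> measure M U"
      using CU s A by (auto intro!: finite_measure_mono)
    ultimately show ?thesis using CU by (intro exI[of _ C] exI[of _ U]) auto
  qed
  show "emeasure M A = (INF U\<in>{U. openin T U \<and> A \<subseteq> U}. emeasure M U)"
  proof (rule antisym)
    show "emeasure M A \<le> (INF U\<in>{U. openin T U \<and> A \<subseteq> U}. emeasure M U)"
      using open_sets by (intro INF_greatest emeasure_mono) auto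
    show "(INF U\<in>{U. openin T U \<and> A \<subseteq> U}. emeasure M U) \<le> emeasure M A"
    proof (rule ennreal_le_epsilon)
      fix e :: real assume "0 < e"
      then obtain U where U: "openin T U" "A \<subseteq> U" "measure M U < measure M A + e"
        using approx by meson
      then have "(INF U\<in>{U. openin T U \<and> A \<subseteq> U}. emeasure M U) \<le> emeasure M U"
        by (intro INF_lower) auto
      also have "\<dots> \<le> emeasure M A + ennreal e"
        using U(3) \<open>0 < e\<close> by (simp add: emeasure_eq_measure ennreal_plus[symmetric] del: ennreal_plus)
      finally show "(INF U\<in>{U. openin T U \<and> A \<subseteq> U}. emeasure M U) \<le> emeasure M A + ennreal e" .
    qed
  qed
  show "emeasure M A = (SUP K\<in>{K. compactin T K \<and> K \<subseteq> A}. emeasure M K)"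
  proof (rule antisym)
    show "(SUP K\<in>{K. compactin T K \<and> K \<subseteq> A}. emeasure M K) \<le> emeasure M A"
      using A by (intro SUP_least emeasure_mono) auto
    show "emeasure M A \<le> (SUP K\<in>{K. compactin T K \<and> K \<subseteq> A}. emeasure M K)"
    proof (rule ennreal_le_epsilon)
      fix e :: real assume "0 < e"
      then obtain C where C: "closedin T C" "C \<subseteq> A" "measure M A < measure M C + e"
        using approx by meson
      have "emeasure M A \<le> emeasure M C + ennreal e"
        using C(3) \<open>0 < e\<close> by (simp add: emeasure_eq_measure ennreal_plus[symmetric] del: ennreal_plus)
      also have "emeasure M C \<le> (SUP K\<in>{K. compactin T K \<and> K \<subseteq> A}. emeasure M K)"
        using C \<open>compact_space T\<close> by (intro SUP_upper) (auto intro: closedin_compact_space)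
      finally show "emeasure M A \<le> (SUP K\<in>{K. compactin T K \<and> K \<subseteq> A}. emeasure M K) + ennreal e"
        by (simp add: add_right_mono)
    qed
  qed
qed


section \<open>Cylinders in the graph space\<close>

text \<open>Allowing an arbitrary family \<open>S\<close> of traces on \<open>F\<close> makes the
  cylinders closed under intersections and complements. The atoms over \<open>F\<close> are the
  cases \<open>S = {A}\<close> with \<open>A \<subseteq> F\<close>.\<close>

definition graph_cylinder :: "'v set \<Rightarrow> 'v set set \<Rightarrow> 'v set set set \<Rightarrow> 'v set set set" where
  "graph_cylinder V F S = {G \<in> graphs V. G \<inter> F \<in> S}"

definition graph_cylinders :: "'v set \<Rightarrow> 'v set set set set" where
  "graph_cylinders V = {graph_cylinder V F S | F S. finite F \<and> F \<subseteq> complete_graph V}"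

text \<open>A trace on \<open>F\<close> is a subset of \<open>F\<close>, so only
  \<open>S \<inter> Pow F\<close> counts. For finite \<open>F\<close> this splits a cylinder into
  finitely many disjoint atoms.\<close>

lemma graph_cylinder_eq_UN: "graph_cylinder V F S = (\<Union>A\<in>S \<inter> Pow F. graph_cylinder V F {A})"
  by (auto simp: graph_cylinder_def)

lemma graph_cylindersI:
  "finite F \<Longrightarrow> F \<subseteq> complete_graph V \<Longrightarrow> graph_cylinder V F S \<in> graph_cylinders V"
  by (auto simp: graph_cylinders_def)

lemma graph_cylinders_subset_Pow: "graph_cylinders V \<subseteq> Pow (graphs V)"
  by (auto simp: graph_cylinders_def graph_cylinder_def)

lemma graphs_in_graph_cylinders: "graphs V \<in> graph_cylinders V"
  using graph_cylindersI[of "{}" V UNIV] by (simp add: graph_cylinder_def)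

lemma Int_stable_graph_cylinders: "Int_stable (graph_cylinders V)"
proof (rule Int_stableI)
  fix a b assume "a \<in> graph_cylinders V" "b \<in> graph_cylinders V"
  then obtain F S F' S' where
    a: "a = graph_cylinder V F S" "finite F" "F \<subseteq> complete_graph V" and
    b: "b = graph_cylinder V F' S'" "finite F'" "F' \<subseteq> complete_graph V"
    by (auto simp: graph_cylinders_def)
  have "G \<inter> (F \<union> F') \<inter> F = G \<inter> F" "G \<inter> (F \<union> F') \<inter> F' = G \<inter> F'" for G by blast+
  \<comment> \<open>The trace on \<open>F \<union> F'\<close> determines the traces on
    \<open>F\<close> and on \<open>F'\<close>, so both conditions can be imposed over this common
    finite set.\<close>
  then have "a \<inter> b = graph_cylinder V (F \<union> F') {A. A \<inter> F \<in> S \<and> A \<inter> F' \<in> S'}"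
    by (auto simp: a b graph_cylinder_def)
  then show "a \<inter> b \<in> graph_cylinders V" using a b by (auto intro: graph_cylindersI)
qed

lemma continuous_map_mem_edge:
  assumes "e \<in> complete_graph V"
  shows "continuous_map (graph_topology V) (discrete_topology UNIV) (\<lambda>G. e \<in> G)"
proof -
  have "continuous_map (graph_topology V) (discrete_topology UNIV) ((\<lambda>f. f e) \<circ> graph_indicator V)"
    unfolding graph_topology_def
    using assms by (intro continuous_map_pullback continuous_map_product_projection)
  then show ?thesis using assms by (simp add: graph_indicator_def o_def)
qed

lemma openin_graph_cylinder:
  assumes "finite F" "F \<subseteq> complete_graph V"
  shows "openin (graph_topology V) (graph_cylinder V F S)"
proof -
  have "openin (graph_topology V) (graph_cylinder V F {A})" if "A \<subseteq> F" for A
  proof -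
    have "openin (graph_topology V) {G \<in> topspace (graph_topology V). (e \<in> G) \<in> {e \<in> A}}"
      if "e \<in> F" for e
      using that assms by (intro openin_continuous_map_preimage[OF continuous_map_mem_edge]) auto
    \<comment> \<open>The extra intersection with the whole space covers \<open>F = {}\<close>,
      where the intersection over \<open>F\<close> alone would be \<open>UNIV\<close>.\<close>
    then have "openin (graph_topology V)
        ((\<Inter>e\<in>F. {G \<in> topspace (graph_topology V). (e \<in> G) \<in> {e \<in> A}}) \<inter> topspace (graph_topology V))"
      using assms(1) openin_topspace[of "graph_topology V"]
      by (cases "F = {}") (auto intro!: openin_Inter openin_Int simp del: topspace_graph_topology)
    also have "(\<Inter>e\<in>F. {G \<in> topspace (graph_topology V). (e \<in> G) \<in> {e \<in> A}}) \<inter> topspace (graph_topology V)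
        = graph_cylinder V F {A}"
      using that by (auto simp: graph_cylinder_def)
    finally show ?thesis .
  qed
  then show ?thesis by (subst graph_cylinder_eq_UN) blast
qed

lemma closedin_graph_cylinder:
  assumes "finite F" "F \<subseteq> complete_graph V"
  shows "closedin (graph_topology V) (graph_cylinder V F S)"
proof -
  have "graphs V - graph_cylinder V F S = graph_cylinder V F (- S)"
    "graph_cylinder V F S \<subseteq> graphs V"
    by (auto simp: graph_cylinder_def)
  then show ?thesis using openin_graph_cylinder[OF assms] by (simp add: closedin_def)
qed

lemma graph_cylinder_neighbourhood:
  assumes "openin (graph_topology V) U" "G \<in> U"
  shows "\<exists>F. finite F \<and> F \<subseteq> complete_graph V \<and> graph_cylinder V F {G \<inter> F} \<subseteq> U"
proof -
  let ?K = "complete_graph V"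
  obtain W where W: "openin (product_topology (\<lambda>_. discrete_topology (UNIV::bool set)) ?K) W"
    and U: "U = graph_indicator V -` W \<inter> graphs V"
    using assms(1) unfolding graph_topology_def openin_pullback_topology by blast
  from assms(2) U have "graph_indicator V G \<in> W" by simp
  with W obtain X where X: "finite {e \<in> ?K. X e \<noteq> UNIV}" "graph_indicator V G \<in> Pi\<^sub>E ?K X"
    "Pi\<^sub>E ?K X \<subseteq> W"
    unfolding openin_product_topology_alt by auto
  \<comment> \<open>A basic open box constrains only finitely many coordinates; agreement with
    \<open>G\<close> on these edges already forces membership in the box.\<close>
  let ?F = "{e \<in> ?K. X e \<noteq> UNIV}"
  have "graph_cylinder V ?F {G \<inter> ?F} \<subseteq> U"
  proof
    fix H assume H: "H \<in> graph_cylinder V ?F {G \<inter> ?F}"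
    have "(e \<in> H) \<in> X e" if "e \<in> ?K" for e
    proof (cases "e \<in> ?F")
      case True
      then have "(e \<in> H) = (e \<in> G)" using H by (auto simp: graph_cylinder_def)
      with X(2) that show ?thesis by (auto simp: graph_indicator_def PiE_iff)
    qed (use that in auto)
    then have "graph_indicator V H \<in> Pi\<^sub>E ?K X" by (auto simp: graph_indicator_def)
    then show "H \<in> U" using X(3) H by (auto simp: U graph_cylinder_def)
  qed
  with X(1) show ?thesis by blast
qed

section \<open>Cylinders generate the Borel sets\<close>

lemma countable_complete_graph:
  assumes "countable V"
  shows "countable (complete_graph V)"
proof -
  have "complete_graph V \<subseteq> (\<lambda>(u, v). {u, v}) ` (V \<times> V)"
    by (auto simp: complete_graph_def)
  then show ?thesis using assms by (meson countable_SIGMA countable_image countable_subset)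
qed

lemma space_graph_borel [simp]: "space (graph_borel V) = graphs V"
  and sets_graph_borel_open:
    "sets (graph_borel V) = sigma_sets (graphs V) {U. openin (graph_topology V) U}"
proof -
  have "{U. openin (graph_topology V) U} \<subseteq> Pow (graphs V)"
    using openin_subset by fastforce
  then show "space (graph_borel V) = graphs V"
    "sets (graph_borel V) = sigma_sets (graphs V) {U. openin (graph_topology V) U}"
    by (simp_all add: graph_borel_def)
qed

lemma sets_graph_borel:
  assumes "countable V"
  shows "sets (graph_borel V) = sigma_sets (graphs V) (graph_cylinders V)"
  unfolding sets_graph_borel_open
proof (rule sigma_sets_eqI)
  fix U assume "U \<in> {U. openin (graph_topology V) U}"
  then have U: "openin (graph_topology V) U" by simp
  let ?fin = "{F. finite F \<and> F \<subseteq> complete_graph V}"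
  \<comment> \<open>\<open>U\<close> is the union of all atoms contained in it. Countability of
    \<open>V\<close> leaves only countably many pairs \<open>(F, A)\<close>, so this union stays in
    the sigma-algebra.\<close>
  let ?I = "{(F, A) \<in> ?fin \<times> ?fin. graph_cylinder V F {A} \<subseteq> U}"
  have "countable ?fin"
    by (intro countable_Collect_finite_subset countable_complete_graph assms)
  then have I: "countable ((\<lambda>(F, A). graph_cylinder V F {A}) ` ?I)"
    by (intro countable_image) (rule countable_subset[OF _ countable_SIGMA], auto)
  have "U \<subseteq> (\<Union>(F, A)\<in>?I. graph_cylinder V F {A})"
  proof
    fix G assume G: "G \<in> U"
    then obtain F where F: "finite F" "F \<subseteq> complete_graph V" "graph_cylinder V F {G \<inter> F} \<subseteq> U"
      using graph_cylinder_neighbourhood[OF U] by blast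
    have "G \<in> graphs V" using openin_subset[OF U] G by auto
    then show "G \<in> (\<Union>(F, A)\<in>?I. graph_cylinder V F {A})"
      using F by (intro UN_I[of "(F, G \<inter> F)"]) (auto simp: graph_cylinder_def)
  qed
  then have "U = \<Union>((\<lambda>(F, A). graph_cylinder V F {A}) ` ?I)" by auto
  moreover have "\<Union>((\<lambda>(F, A). graph_cylinder V F {A}) ` ?I) \<in> sigma_sets (graphs V) (graph_cylinders V)"
    by (rule sigma_sets_UNION[OF I]) (auto intro: graph_cylindersI)
  ultimately show "U \<in> sigma_sets (graphs V) (graph_cylinders V)" by simp
next
  fix a assume "a \<in> graph_cylinders V"
  then show "a \<in> sigma_sets (graphs V) {U. openin (graph_topology V) U}"
    by (auto simp: graph_cylinders_def intro: openin_graph_cylinder)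
qed

section \<open>Measures determined by their values on atoms\<close>

lemma emeasure_graph_cylinder:
  assumes "sets M = sets (graph_borel V)" "finite F" "F \<subseteq> complete_graph V"
  shows "emeasure M (graph_cylinder V F S) = (\<Sum>A\<in>S \<inter> Pow F. emeasure M (graph_cylinder V F {A}))"
proof -
  have "graph_cylinder V F T \<in> sets M" for T
    using openin_graph_cylinder[OF assms(2,3)] by (auto simp: assms(1) sets_graph_borel_open)
  moreover have "disjoint_family_on (\<lambda>A. graph_cylinder V F {A}) (S \<inter> Pow F)"
    by (auto simp: disjoint_family_on_def graph_cylinder_def)
  ultimately show ?thesis
    unfolding graph_cylinder_eq_UN[of V F S]
    using assms(2) by (intro sum_emeasure[symmetric]) auto
qed

text \<open>Equal atoms reduce measuring to counting traces. With \<open>S = UNIV\<close> this fixes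
  the mass of an atom under an invariant probability measure; with general \<open>S\<close> it
  evaluates the fair measure.\<close>

lemma emeasure_graph_cylinder_card:
  assumes "sets M = sets (graph_borel V)" "finite F" "F \<subseteq> complete_graph V"
    and "\<And>A. A \<subseteq> F \<Longrightarrow> emeasure M (graph_cylinder V F {A}) = ennreal c" "0 \<le> c"
  shows "emeasure M (graph_cylinder V F S) = ennreal (real (card (S \<inter> Pow F)) * c)"
proof -
  have "emeasure M (graph_cylinder V F S) = (\<Sum>A\<in>S \<inter> Pow F. ennreal c)"
    unfolding emeasure_graph_cylinder[OF assms(1-3), of S] using assms(4) by (intro sum.cong) auto
  then show ?thesis
    using assms(5) by (simp add: ennreal_mult ennreal_of_nat_eq_real_of_nat)
qed

text \<open>Finite additivity extends the agreement from atoms to all cylinders, which form a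
  generating \<pi>-system.\<close>

lemma graph_measure_eqI:
  assumes "countable V" "sets M = sets (graph_borel V)" "sets N = sets (graph_borel V)"
    and "finite_measure M"
    and eq: "\<And>F A. finite F \<Longrightarrow> F \<subseteq> complete_graph V \<Longrightarrow> A \<subseteq> F \<Longrightarrow>
      emeasure M (graph_cylinder V F {A}) = emeasure N (graph_cylinder V F {A})"
  shows "M = N"
proof (rule measure_eqI_generator_eq[where A = "\<lambda>_. graphs V"])
  interpret finite_measure M by fact
  show "sets M = sigma_sets (graphs V) (graph_cylinders V)"
    "sets N = sigma_sets (graphs V) (graph_cylinders V)"
    using assms(2,3) sets_graph_borel[OF assms(1)] by simp_all
  \<comment> \<open>The whole space is itself a cylinder, so the constant sequence
    \<open>graphs V\<close> serves as the exhaustion by sets of finite measure.\<close>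
  show "emeasure M (graphs V) \<noteq> \<infinity>" by simp
  fix X assume "X \<in> graph_cylinders V"
  then obtain F S where X: "X = graph_cylinder V F S" and F: "finite F" "F \<subseteq> complete_graph V"
    by (auto simp: graph_cylinders_def)
  show "emeasure M X = emeasure N X"
    unfolding X emeasure_graph_cylinder[OF assms(2) F, of S] emeasure_graph_cylinder[OF assms(3) F, of S]
    using eq F by (intro sum.cong) auto
qed (use graphs_in_graph_cylinders graph_cylinders_subset_Pow Int_stable_graph_cylinders in auto)


section \<open>Haar measure is the product measure\<close>

text \<open>Translation by \<open>A\<close> is an involution, so a preimage of \<open>H\<close> is
  found by translating back. Hence every atom over \<open>F\<close> is a translate of the one with
  empty trace.\<close>

lemma sym_diff_image_graph_cylinder:
  assumes "F \<subseteq> complete_graph V" "A \<subseteq> F"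
  shows "sym_diff A ` graph_cylinder V F {{}} = graph_cylinder V F {A}"
proof (intro subset_antisym subsetI)
  fix H assume "H \<in> graph_cylinder V F {A}"
  then have "sym_diff A H \<in> graph_cylinder V F {{}}" "H = sym_diff A (sym_diff A H)"
    using assms by (auto simp: graph_cylinder_def graphs_def)
  then show "H \<in> sym_diff A ` graph_cylinder V F {{}}" by blast
qed (use assms in \<open>auto simp: graph_cylinder_def graphs_def\<close>)

lemma haar_probability_graph_cylinder:
  assumes "haar_probability (graph_group V) (graph_topology V) M"
    and F: "finite F" "F \<subseteq> complete_graph V" "A \<subseteq> F"
  shows "emeasure M (graph_cylinder V F {A}) = ennreal ((1/2) ^ card F)"
proof -
  interpret prob_space M using assms(1) by (simp add: haar_probability_def)
  have sets: "sets M = sets (graph_borel V)"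
    using assms(1) by (simp add: haar_probability_def sets_graph_borel_open)
  have cyl: "graph_cylinder V F S \<in> sets M" for S
    using openin_graph_cylinder[OF F(1,2)] by (auto simp: sets sets_graph_borel_open)
  have transl: "emeasure M (graph_cylinder V F {B}) = emeasure M (graph_cylinder V F {{}})"
    if "B \<subseteq> F" for B
  proof -
    have "emeasure M (sym_diff B ` graph_cylinder V F {{}}) = emeasure M (graph_cylinder V F {{}})"
      using assms(1) cyl that F(2) by (auto simp: haar_probability_def graph_group_def graphs_def)
    then show ?thesis using sym_diff_image_graph_cylinder[OF F(2) that] by simp
  qed
  define c where "c = measure M (graph_cylinder V F {{}})"
  have c: "emeasure M (graph_cylinder V F {B}) = ennreal c" if "B \<subseteq> F" for B
    unfolding transl[OF that] c_def by (rule emeasure_eq_measure)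
  \<comment> \<open>Admitting every trace gives the whole space, so the \<open>2 ^ card F\<close>
    equal atoms have total mass 1.\<close>
  have "graph_cylinder V F UNIV = space M"
    using sets_eq_imp_space_eq[OF sets] by (simp add: graph_cylinder_def)
  then have "1 = emeasure M (graph_cylinder V F UNIV)" by (simp add: emeasure_space_1)
  also have "\<dots> = ennreal (real (card (Pow F)) * c)"
    using emeasure_graph_cylinder_card[OF sets F(1,2) c, of UNIV] by (simp add: c_def)
  finally have "2 ^ card F * c = 1"
    using F(1) by (simp add: card_Pow c_def)
  then have "c = (1/2) ^ card F" by (simp add: power_one_over field_simps)
  then show ?thesis using c[OF F(3)] by simp
qed

section \<open>The fair measure of cylinders\<close>

text \<open>Prescribing a trace prescribes finitely many coordinates. The factor
  \<open>{e \<in> A}\<close> is the singleton of a truth value, so the box fixes each coordinate in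
  \<open>F\<close>.\<close>

lemma vimage_graph_of_indicator_cylinder:
  assumes "F \<subseteq> complete_graph V" "A \<subseteq> F"
  shows "graph_of_indicator V -` graph_cylinder V F {A} \<inter> space (PiM (complete_graph V) (\<lambda>_. measure_pmf p))
    = prod_emb (complete_graph V) (\<lambda>_. measure_pmf p) F (\<Pi>\<^sub>E e\<in>F. {e \<in> A})"
proof -
  have "graph_of_indicator V f \<in> graph_cylinder V F {A} \<longleftrightarrow> (\<forall>e\<in>F. f e = (e \<in> A))" for f
    using assms by (auto simp: graph_of_indicator_def graph_cylinder_def graphs_def)
  then show ?thesis
    by (auto simp: prod_emb_def space_PiM PiE_iff)
qed

text \<open>It suffices to test the generating cylinders; their preimages are finite unions of
  measurable boxes.\<close>

lemma measurable_graph_of_indicator: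
  assumes "countable V"
  shows "graph_of_indicator V \<in> measurable (PiM (complete_graph V) (\<lambda>_. measure_pmf p)) (graph_borel V)"
proof (rule measurable_sigma_sets[OF sets_graph_borel[OF assms] graph_cylinders_subset_Pow])
  fix a assume "a \<in> graph_cylinders V"
  then obtain F S where a: "a = graph_cylinder V F S" and F: "finite F" "F \<subseteq> complete_graph V"
    by (auto simp: graph_cylinders_def)
  let ?P = "PiM (complete_graph V) (\<lambda>_. measure_pmf p)"
  have "graph_of_indicator V -` a \<inter> space ?P
      = (\<Union>A\<in>S \<inter> Pow F. graph_of_indicator V -` graph_cylinder V F {A} \<inter> space ?P)"
    unfolding a graph_cylinder_eq_UN[of V F S] by blast
  also have "\<dots> \<in> sets ?P"
    using F by (intro sets.finite_UN) (auto simp: vimage_graph_of_indicator_cylinder intro!: sets_PiM_I)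
  finally show "graph_of_indicator V -` a \<inter> space ?P \<in> sets ?P" .
qed (auto simp: graph_of_indicator_def graphs_def)

lemma sets_fair_graph_measure [simp]: "sets (fair_graph_measure V) = sets (graph_borel V)"
  and space_fair_graph_measure [simp]: "space (fair_graph_measure V) = graphs V"
  by (simp_all add: fair_graph_measure_def)

lemma prob_space_fair_graph_measure:
  assumes "countable V"
  shows "prob_space (fair_graph_measure V)"
  unfolding fair_graph_measure_def
  by (intro prob_space.prob_space_distr prob_space_PiM measurable_graph_of_indicator assms)
    (rule prob_space_measure_pmf)

lemma fair_graph_measure_graph_cylinder:
  assumes "countable V" and F: "finite F" "F \<subseteq> complete_graph V" "A \<subseteq> F"
  shows "emeasure (fair_graph_measure V) (graph_cylinder V F {A}) = ennreal ((1/2) ^ card F)"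
proof -
  \<comment> \<open>Both outcomes of a fair coin have equal mass, so the product over
    \<open>F\<close> depends on \<open>card F\<close> but not on the trace \<open>A\<close>.\<close>
  have half: "emeasure (measure_pmf (bernoulli_pmf (1/2))) {b} = ennreal (1/2)" for b
    by (cases b) (simp_all add: emeasure_pmf_single)
  have "graph_cylinder V F {A} \<in> sets (graph_borel V)"
    using openin_graph_cylinder[OF F(1,2)] by (auto simp: sets_graph_borel_open)
  then have "emeasure (fair_graph_measure V) (graph_cylinder V F {A})
      = (\<Prod>e\<in>F. emeasure (measure_pmf (bernoulli_pmf (1/2))) {e \<in> A})"
    unfolding fair_graph_measure_def
    by (simp add: emeasure_distr measurable_graph_of_indicator assms vimage_graph_of_indicator_cylinder
        emeasure_PiM_emb prob_space_measure_pmf)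
  also have "\<dots> = ennreal (1/2) ^ card F" by (simp only: half prod_constant)
  also have "\<dots> = ennreal ((1/2) ^ card F)" by (rule ennreal_power) simp
  finally show ?thesis .
qed

lemma measure_fair_graph_cylinder:
  assumes "countable V" "finite F" "F \<subseteq> complete_graph V"
  shows "measure (fair_graph_measure V) (graph_cylinder V F S) = card (S \<inter> Pow F) / 2 ^ card F"
proof -
  have "emeasure (fair_graph_measure V) (graph_cylinder V F S)
      = ennreal (real (card (S \<inter> Pow F)) * (1/2) ^ card F)"
    by (rule emeasure_graph_cylinder_card[OF _ assms(2,3)])
      (simp_all add: fair_graph_measure_graph_cylinder assms)
  then show ?thesis by (simp add: measure_def power_one_over)
qed

section \<open>Translation invariance and regularity of the fair measure\<close>

text \<open>Symmetric difference acts edge by edge, and edges outside \<open>F\<close> belong to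
  neither side of the comparison. A translation therefore permutes the atoms over
  \<open>F\<close>.\<close>

lemma vimage_sym_diff_graph_cylinder:
  assumes "g \<in> graphs V" "A \<subseteq> F"
  shows "sym_diff g -` graph_cylinder V F {A} \<inter> graphs V = graph_cylinder V F {sym_diff A (g \<inter> F)}"
proof -
  have "((x \<in> sym_diff g G \<inter> F) = (x \<in> A)) = ((x \<in> G \<inter> F) = (x \<in> sym_diff A (g \<inter> F)))" for x G
    using assms(2) by (cases "x \<in> F"; cases "x \<in> A") auto
  then have eq: "sym_diff g G \<inter> F = A \<longleftrightarrow> G \<inter> F = sym_diff A (g \<inter> F)" for G
    by (simp only: set_eq_iff)
  have mem: "sym_diff g G \<in> graphs V" if "G \<in> graphs V" for G
    using sym_diff_in_graphs[OF assms(1) that] .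
  show ?thesis
  proof (rule Set.set_eqI)
    fix G
    show "G \<in> sym_diff g -` graph_cylinder V F {A} \<inter> graphs V
        \<longleftrightarrow> G \<in> graph_cylinder V F {sym_diff A (g \<inter> F)}"
      by (cases "G \<in> graphs V")
        (simp_all only: vimage_eq Int_iff graph_cylinder_def mem_Collect_eq singleton_iff eq mem simp_thms)
  qed
qed

text \<open>Fixing one argument of the continuous group operation gives a continuous, hence Borel
  measurable, translation.\<close>

lemma measurable_sym_diff_graph_borel:
  assumes "g \<in> graphs V"
  shows "sym_diff g \<in> measurable (graph_borel V) (graph_borel V)"
proof -
  have "continuous_map (graph_topology V) (graph_topology V)
      ((\<lambda>(x, y). sym_diff x y) \<circ> (\<lambda>x. (g, x)))"
    using compact_abelian_group_graph_group[of V] assms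
    by (intro continuous_map_compose[of _ "prod_topology (graph_topology V) (graph_topology V)"])
      (auto simp: compact_abelian_group_def graph_group_def continuous_map_paired o_def)
  then have cont: "continuous_map (graph_topology V) (graph_topology V) (sym_diff g)"
    by (simp add: o_def)
  show ?thesis
  proof (rule measurable_sigma_sets[OF sets_graph_borel_open])
    fix U assume "U \<in> {U. openin (graph_topology V) U}"
    then have "openin (graph_topology V) {x \<in> topspace (graph_topology V). sym_diff g x \<in> U}"
      using openin_continuous_map_preimage[OF cont] by blast
    moreover have "{x \<in> topspace (graph_topology V). sym_diff g x \<in> U}
        = sym_diff g -` U \<inter> space (graph_borel V)" by auto
    ultimately show "sym_diff g -` U \<inter> space (graph_borel V) \<in> sets (graph_borel V)"
      by (auto simp: sets_graph_borel_open)
  next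
    show "{U. openin (graph_topology V) U} \<subseteq> Pow (graphs V)"
      using openin_subset by fastforce
    show "sym_diff g \<in> space (graph_borel V) \<rightarrow> graphs V"
      using sym_diff_in_graphs[OF assms] by simp
  qed
qed

text \<open>Translations permute the atoms over \<open>F\<close>, all of the same fair measure;
  agreement on atoms identifies the two measures.\<close>

lemma fair_graph_measure_translate:
  assumes "countable V" and g: "g \<in> graphs V"
  shows "distr (fair_graph_measure V) (graph_borel V) (sym_diff g) = fair_graph_measure V"
proof (rule graph_measure_eqI)
  let ?M = "fair_graph_measure V"
  interpret prob_space ?M by (rule prob_space_fair_graph_measure) fact
  have meas: "sym_diff g \<in> measurable ?M (graph_borel V)"
    using measurable_sym_diff_graph_borel[OF g] by (simp cong: measurable_cong_sets)
  then show "finite_measure (distr ?M (graph_borel V) (sym_diff g))"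
    by (rule finite_measure_distr)
  fix F A assume F: "finite F" "F \<subseteq> complete_graph V" and A: "A \<subseteq> F"
  have "graph_cylinder V F {A} \<in> sets (graph_borel V)"
    using openin_graph_cylinder[OF F] by (auto simp: sets_graph_borel_open)
  then have "emeasure (distr ?M (graph_borel V) (sym_diff g)) (graph_cylinder V F {A})
      = emeasure ?M (graph_cylinder V F {sym_diff A (g \<inter> F)})"
    by (subst emeasure_distr[OF meas])
      (simp_all only: space_fair_graph_measure vimage_sym_diff_graph_cylinder[OF g A])
  also have "\<dots> = emeasure ?M (graph_cylinder V F {A})"
  proof -
    have "sym_diff A (g \<inter> F) \<subseteq> F" using A by blast
    then show ?thesis
      by (simp only: fair_graph_measure_graph_cylinder[OF assms(1) F] A)
  qed
  finally show "emeasure (distr ?M (graph_borel V) (sym_diff g)) (graph_cylinder V F {A})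
      = emeasure ?M (graph_cylinder V F {A})" .
qed (use assms in simp_all)

lemma haar_probability_fair_graph_measure:
  assumes "countable V"
  shows "haar_probability (graph_group V) (graph_topology V) (fair_graph_measure V)"
proof -
  let ?M = "fair_graph_measure V" and ?T = "graph_topology V"
  interpret prob_space ?M by (rule prob_space_fair_graph_measure) fact
  have transl: "emeasure ?M (sym_diff g ` A) = emeasure ?M A"
    if g: "g \<in> graphs V" and A: "A \<in> sets ?M" for g A
  proof -
    have sub: "A \<subseteq> graphs V" using sets.sets_into_space[OF A] by simp
    have inv: "sym_diff g (sym_diff g x) = x" for x by blast
    \<comment> \<open>Image measures are computed by preimages, whereas invariance is phrased with
      images. For the involution \<open>sym_diff g\<close> the two coincide.\<close>
    have "sym_diff g -` A \<inter> graphs V = sym_diff g ` A"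
    proof (intro subset_antisym subsetI)
      fix x assume "x \<in> sym_diff g -` A \<inter> graphs V"
      then have "sym_diff g x \<in> A" by simp
      then have "sym_diff g (sym_diff g x) \<in> sym_diff g ` A" by (rule imageI)
      then show "x \<in> sym_diff g ` A" unfolding inv .
    next
      fix x assume "x \<in> sym_diff g ` A"
      then obtain y where y: "y \<in> A" "x = sym_diff g y" by blast
      then have "sym_diff g x \<in> A" by (simp only: inv)
      moreover have "x \<in> graphs V"
        unfolding y(2) using sym_diff_in_graphs[OF g] y(1) sub by blast
      ultimately show "x \<in> sym_diff g -` A \<inter> graphs V" by blast
    qed
    moreover have "sym_diff g \<in> measurable ?M (graph_borel V)"
      using measurable_sym_diff_graph_borel[OF g] by (simp cong: measurable_cong_sets)
    ultimately have "emeasure (distr ?M (graph_borel V) (sym_diff g)) A = emeasure ?M (sym_diff g ` A)"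
      using A by (subst emeasure_distr) (simp_all only: space_fair_graph_measure sets_fair_graph_measure)
    then show ?thesis by (simp only: fair_graph_measure_translate[OF assms g])
  qed
  have compact: "compact_space ?T"
    using compact_abelian_group_graph_group by (auto simp: compact_abelian_group_def)
  have clopen: "openin ?T b \<and> closedin ?T b" if "b \<in> graph_cylinders V" for b
    using that by (auto simp: graph_cylinders_def intro: openin_graph_cylinder closedin_graph_cylinder)
  have sets: "sets ?M = sigma_sets (topspace ?T) (graph_cylinders V)"
    using sets_graph_borel[OF assms] by simp
  have open_sets: "U \<in> sets ?M" if "openin ?T U" for U
    using that by (auto simp: sets_graph_borel_open)
  note regular = finite_measure_axioms compact sets clopen open_sets
  show ?thesis
    unfolding haar_probability_def
    \<comment> \<open>Outer regularity is taken for all Borel sets, inner regularity only for open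
      ones, as the definition of Haar measure asks.\<close>
    using outer_regular_if_generated_by_clopen[OF regular]
      inner_regular_if_generated_by_clopen[OF regular open_sets] transl prob_space_axioms
    by (simp add: graph_group_def sets_graph_borel_open)
qed

text \<open>Existence is the preceding lemma; uniqueness holds because invariance and total mass 1
  determine the mass of every atom.\<close>

lemma haar_probability_graph_iff:
  assumes "countable V"
  shows "haar_probability (graph_group V) (graph_topology V) \<mu> \<longleftrightarrow> \<mu> = fair_graph_measure V"
proof
  assume haar: "haar_probability (graph_group V) (graph_topology V) \<mu>"
  then interpret prob_space \<mu> by (simp add: haar_probability_def)
  have "sets \<mu> = sets (graph_borel V)"
    using haar by (simp add: haar_probability_def sets_graph_borel_open)
  then show "\<mu> = fair_graph_measure V"
  proof (rule graph_measure_eqI[OF assms])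
    fix F A assume F: "finite F" "F \<subseteq> complete_graph V" "A \<subseteq> F"
    show "emeasure \<mu> (graph_cylinder V F {A}) = emeasure (fair_graph_measure V) (graph_cylinder V F {A})"
      unfolding haar_probability_graph_cylinder[OF haar F]
        fair_graph_measure_graph_cylinder[OF assms F] ..
  qed (rule sets_fair_graph_measure finite_measure_axioms)+
qed (simp add: haar_probability_fair_graph_measure assms)


section \<open>Measures of balls\<close>

text \<open>The geometric series with exponents from 1 on has sum 1; it is carried to the edges
  along \<open>Suc\<close> and then \<psi>.\<close>

lemma edge_weights_has_sum:
  assumes "bij_betw \<psi> E {1..}"
  shows "((\<lambda>e. 1 / 2 ^ \<psi> e :: real) has_sum 1) E"
proof -
  have "((\<lambda>n. (1/2) ^ Suc n :: real) has_sum 1) UNIV"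
    by (rule sums_nonneg_imp_has_sum[OF power_half_series]) simp
  moreover have "bij_betw Suc UNIV {1..}"
    by (rule bij_betw_byWitness[where f' = "\<lambda>n. n - 1"]) auto
  ultimately have "((\<lambda>n. (1/2) ^ n :: real) has_sum 1) {1..}"
    using has_sum_reindex_bij_betw[of Suc UNIV "{1..}" "\<lambda>n. (1/2::real) ^ n" 1] by simp
  then have "((\<lambda>e. (1/2) ^ \<psi> e :: real) has_sum 1) E"
    using has_sum_reindex_bij_betw[OF assms, of "\<lambda>n. (1/2::real) ^ n" 1] by simp
  then show ?thesis by (simp add: power_one_over)
qed

text \<open>The total edge weight is 1 and splits between \<open>H\<close> and its complement. This
  reflection later exchanges open and closed balls.\<close>

lemma graph_norm_Diff:
  assumes "bij_betw \<psi> E {1..}" "H \<subseteq> E"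
  shows "graph_norm \<psi> (E - H) = 1 - graph_norm \<psi> H"
proof -
  note sum = edge_weights_has_sum[OF assms(1)]
  note summable = has_sum_imp_summable[OF sum]
  show ?thesis
    unfolding graph_norm_def
    using infsum_Diff[OF summable summable_on_subset_banach[OF summable assms(2)] assms(2)]
    by (simp add: infsumI[OF sum])
qed

text \<open>The edge labelled \<open>k\<close> carries the \<open>k\<close>-th binary digit of the
  norm, so these are its first \<open>n\<close> digits.\<close>

definition first_edges :: "'v set \<Rightarrow> ('v set \<Rightarrow> nat) \<Rightarrow> nat \<Rightarrow> 'v set set" where
  "first_edges V \<psi> n = {e \<in> complete_graph V. \<psi> e \<le> n}"

lemma bij_betw_first_edges:
  assumes "bij_betw \<psi> (complete_graph V) {1..}"
  shows "bij_betw \<psi> (first_edges V \<psi> n) {1..n}"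
  unfolding bij_betw_def
proof
  show "inj_on \<psi> (first_edges V \<psi> n)"
    using assms by (auto simp: bij_betw_def first_edges_def inj_on_def)
  show "\<psi> ` first_edges V \<psi> n = {1..n}"
  proof (intro subset_antisym subsetI)
    fix k assume k: "k \<in> {1..n}"
    then have "k \<in> \<psi> ` complete_graph V" using assms by (simp add: bij_betw_def)
    then show "k \<in> \<psi> ` first_edges V \<psi> n" using k by (auto simp: first_edges_def)
  next
    fix k assume "k \<in> \<psi> ` first_edges V \<psi> n"
    then show "k \<in> {1..n}" using bij_betwE[OF assms] by (auto simp: first_edges_def)
  qed
qed

text \<open>The norm is the supremum of its partial sums, because the weights are nonnegative and a
  finite set of edges has bounded labels. A weak bound passes to a supremum, a strict one need not;
  hence closed balls come first.\<close>

lemma graph_norm_le_iff: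
  assumes bij: "bij_betw \<psi> (complete_graph V) {1..}" and H: "H \<in> graphs V"
  shows "graph_norm \<psi> H \<le> \<epsilon> \<longleftrightarrow> (\<forall>n. (\<Sum>e\<in>H \<inter> first_edges V \<psi> n. 1 / 2 ^ \<psi> e) \<le> \<epsilon>)"
proof -
  have sub: "H \<subseteq> complete_graph V" using H by (simp add: graphs_def)
  have fin: "finite (first_edges V \<psi> n)" for n
    using bij_betw_first_edges[OF bij] bij_betw_finite by blast
  have summable: "(\<lambda>e. 1 / 2 ^ \<psi> e :: real) summable_on H"
    using has_sum_imp_summable[OF edge_weights_has_sum[OF bij]] sub
    by (rule summable_on_subset_banach)
  have "(\<Sum>e\<in>H \<inter> first_edges V \<psi> n. 1 / 2 ^ \<psi> e) \<le> graph_norm \<psi> H" for n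
    unfolding graph_norm_def using fin by (intro finite_sum_le_infsum summable) auto
  moreover have "graph_norm \<psi> H \<le> \<epsilon>" if "\<forall>n. (\<Sum>e\<in>H \<inter> first_edges V \<psi> n. 1 / 2 ^ \<psi> e) \<le> \<epsilon>"
    unfolding graph_norm_def
  proof (rule infsum_le_finite_sums[OF summable])
    fix A assume A: "finite A" "A \<subseteq> H"
    then obtain n where "\<psi> ` A \<subseteq> {..n}" using finite_nat_iff_bounded_le by blast
    then have "A \<subseteq> H \<inter> first_edges V \<psi> n" using A sub by (auto simp: first_edges_def)
    then have "(\<Sum>e\<in>A. 1 / 2 ^ \<psi> e :: real) \<le> (\<Sum>e\<in>H \<inter> first_edges V \<psi> n. 1 / 2 ^ \<psi> e)"
      using fin by (intro sum_mono2) auto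
    then show "(\<Sum>e\<in>A. 1 / 2 ^ \<psi> e) \<le> \<epsilon>" using that by (meson order_trans)
  qed
  ultimately show ?thesis by (meson order_trans)
qed

text \<open>Uniqueness of binary expansions: the sums are distinct multiples of \<open>2\<^bsup>-n\<^esup>\<close>.\<close>

lemma card_edge_subsets_le:
  assumes bij: "bij_betw \<psi> E {1..n}" and "0 \<le> \<epsilon>"
  shows "real (card {A \<in> Pow E. (\<Sum>e\<in>A. 1 / 2 ^ \<psi> e) \<le> \<epsilon>}) \<le> \<epsilon> * 2 ^ n + 1"
proof -
  \<comment> \<open>Putting the edge \<open>e\<close> at bit \<open>n - \<psi> e\<close> makes
    \<open>k A\<close> the partial sum scaled by \<open>2 ^ n\<close>; injectivity of the binary
    encoding then separates the subsets.\<close>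
  define k where "k A = set_encode ((\<lambda>e. n - \<psi> e) ` A)" for A
  have fin: "finite A" if "A \<subseteq> E" for A
    using that bij_betw_finite[OF bij] finite_subset by blast
  have range: "\<psi> e \<le> n" if "e \<in> E" for e using bij_betwE[OF bij] that by auto
  have inj: "inj_on (\<lambda>e. n - \<psi> e) E"
  proof (rule inj_onI)
    fix d e assume "d \<in> E" "e \<in> E" "n - \<psi> d = n - \<psi> e"
    then have "\<psi> d = \<psi> e" using range by (metis diff_diff_cancel)
    then show "d = e" using bij \<open>d \<in> E\<close> \<open>e \<in> E\<close> by (meson bij_betw_imp_inj_on inj_onD)
  qed
  have k: "real (k A) = 2 ^ n * (\<Sum>e\<in>A. 1 / 2 ^ \<psi> e)" if "A \<subseteq> E" for A
  proof -
    have "k A = (\<Sum>e\<in>A. 2 ^ (n - \<psi> e))"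
      unfolding k_def set_encode_def
      by (subst sum.reindex[OF inj_on_subset[OF inj that]]) simp
    then show ?thesis
      using range that by (auto simp: sum_distrib_left power_diff intro!: sum.cong)
  qed
  have "inj_on k (Pow E)"
  proof (rule inj_onI)
    fix A B assume "A \<in> Pow E" "B \<in> Pow E" "k A = k B"
    then have "(\<lambda>e. n - \<psi> e) ` A = (\<lambda>e. n - \<psi> e) ` B"
      using fin by (simp add: k_def set_encode_eq)
    then show "A = B" using inj_on_image_eq_iff[OF inj] \<open>A \<in> Pow E\<close> \<open>B \<in> Pow E\<close> by simp
  qed
  \<comment> \<open>The codes range over naturals from 0 up to
    \<open>\<lfloor>\<epsilon> * 2 ^ n\<rfloor>\<close>; counting 0 produces the summand 1 in the
    bound.\<close>
  then have "card {A \<in> Pow E. (\<Sum>e\<in>A. 1 / 2 ^ \<psi> e) \<le> \<epsilon>} \<le> card {..nat \<lfloor>\<epsilon> * 2 ^ n\<rfloor>}"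
  proof (intro card_inj_on_le)
    show "k ` {A \<in> Pow E. (\<Sum>e\<in>A. 1 / 2 ^ \<psi> e) \<le> \<epsilon>} \<subseteq> {..nat \<lfloor>\<epsilon> * 2 ^ n\<rfloor>}"
    proof clarsimp
      fix A assume "A \<subseteq> E" "(\<Sum>e\<in>A. 1 / 2 ^ \<psi> e) \<le> \<epsilon>"
      then have "real (k A) \<le> \<epsilon> * 2 ^ n" by (simp add: k)
      then show "k A \<le> nat \<lfloor>\<epsilon> * 2 ^ n\<rfloor>" by (simp add: le_nat_floor)
    qed
  qed (auto intro: inj_on_subset)
  then have "real (card {A \<in> Pow E. (\<Sum>e\<in>A. 1 / 2 ^ \<psi> e) \<le> \<epsilon>}) \<le> real (nat \<lfloor>\<epsilon> * 2 ^ n\<rfloor>) + 1"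
    by simp
  also have "real (nat \<lfloor>\<epsilon> * 2 ^ n\<rfloor>) \<le> \<epsilon> * 2 ^ n" using assms(2) by simp
  finally show ?thesis by simp
qed

section \<open>Closed balls, then open balls by reflection\<close>

text \<open>Each partial-sum condition depends only on the trace on the first \<open>n\<close>
  edges. The resulting cylinders give measurability of the ball and upper bounds for its
  measure.\<close>

lemma graph_closed_ball_eq_INT:
  assumes bij: "bij_betw \<psi> (complete_graph V) {1..}" and G: "G \<in> graphs V"
  shows "graph_closed_ball V \<psi> G \<epsilon> = (\<Inter>n. graph_cylinder V (first_edges V \<psi> n)
    {A. (\<Sum>e\<in>sym_diff A (G \<inter> first_edges V \<psi> n). 1 / 2 ^ \<psi> e) \<le> \<epsilon>})"
proof -
  have "sym_diff H G \<inter> F = sym_diff (H \<inter> F) (G \<inter> F)" for H F by blast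
  then show ?thesis
    using graph_norm_le_iff[OF bij] sym_diff_in_graphs[OF _ G]
    by (auto simp: graph_closed_ball_def graph_cylinder_def)
qed

lemma graph_closed_ball_sets:
  assumes bij: "bij_betw \<psi> (complete_graph V) {1..}" and G: "G \<in> graphs V"
  shows "graph_closed_ball V \<psi> G \<epsilon> \<in> sets (graph_borel V)"
proof -
  have "graph_cylinder V (first_edges V \<psi> n) S \<in> sets (graph_borel V)" for n S
    using openin_graph_cylinder[of "first_edges V \<psi> n" V] bij_betw_finite[OF bij_betw_first_edges[OF bij]]
    by (auto simp: sets_graph_borel_open first_edges_def)
  then show ?thesis
    unfolding graph_closed_ball_eq_INT[OF assms] by (intro sets.countable_INT) auto
qed

lemma measure_graph_closed_ball_le:
  assumes "countable V" and bij: "bij_betw \<psi> (complete_graph V) {1..}" and G: "G \<in> graphs V"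
    and "0 \<le> \<epsilon>"
  shows "measure (fair_graph_measure V) (graph_closed_ball V \<psi> G \<epsilon>) \<le> \<epsilon>"
proof -
  interpret prob_space "fair_graph_measure V" by (rule prob_space_fair_graph_measure) fact
  have "measure (fair_graph_measure V) (graph_closed_ball V \<psi> G \<epsilon>) \<le> \<epsilon> + (1/2) ^ n" for n
  proof -
    let ?F = "first_edges V \<psi> n"
    let ?S = "{A. (\<Sum>e\<in>sym_diff A (G \<inter> ?F). 1 / 2 ^ \<psi> e) \<le> \<epsilon>}"
    let ?T = "{A \<in> Pow ?F. (\<Sum>e\<in>A. 1 / 2 ^ \<psi> e) \<le> \<epsilon>}"
    note bF = bij_betw_first_edges[OF bij, of n]
    have F: "finite ?F" "?F \<subseteq> complete_graph V" "card ?F = n"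
      using bij_betw_finite[OF bF] bij_betw_same_card[OF bF] by (auto simp: first_edges_def)
    have cancel: "sym_diff (sym_diff A (G \<inter> ?F)) (G \<inter> ?F) = A" for A by blast
    \<comment> \<open>Translation by the trace of \<open>G\<close> is injective and moves the centre
      to the empty graph, reducing the count to subset sums.\<close>
    have "card (?S \<inter> Pow ?F) \<le> card ?T"
    proof (rule card_inj_on_le)
      show "inj_on (\<lambda>A. sym_diff A (G \<inter> ?F)) (?S \<inter> Pow ?F)"
        by (rule inj_on_inverseI[where g = "\<lambda>A. sym_diff A (G \<inter> ?F)"]) (rule cancel)
    qed (use F in auto)
    also have "real (card ?T) \<le> \<epsilon> * 2 ^ n + 1"
      using card_edge_subsets_le[OF bF] \<open>0 \<le> \<epsilon>\<close> by blast
    finally have card: "real (card (?S \<inter> Pow ?F)) \<le> \<epsilon> * 2 ^ n + 1" by simp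
    have "measure (fair_graph_measure V) (graph_closed_ball V \<psi> G \<epsilon>)
        \<le> measure (fair_graph_measure V) (graph_cylinder V ?F ?S)"
      using openin_graph_cylinder[OF F(1,2)]
      by (intro finite_measure_mono) (auto simp: graph_closed_ball_eq_INT[OF bij G] sets_graph_borel_open)
    also have "\<dots> \<le> (\<epsilon> * 2 ^ n + 1) / 2 ^ n"
      using card F by (simp add: measure_fair_graph_cylinder assms(1) divide_right_mono)
    finally show ?thesis by (simp add: add_divide_distrib power_one_over)
  qed
  \<comment> \<open>The bound holds for every \<open>n\<close>, so letting \<open>n\<close> grow
    removes the error term.\<close>
  moreover have "(\<lambda>n. \<epsilon> + (1/2::real) ^ n) \<longlonglongrightarrow> \<epsilon> + 0"
    by (intro tendsto_intros LIMSEQ_power_zero) simp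
  ultimately show ?thesis by (intro LIMSEQ_le_const[where X = "\<lambda>n. \<epsilon> + (1/2) ^ n"]) auto
qed

text \<open>Complementing the centre complements each symmetric difference, so the norm
  \<open>r\<close> becomes \<open>1 - r\<close>. Lying in the closed ball of radius
  \<open>1 - \<epsilon>\<close> then means \<open>r \<ge> \<epsilon>\<close>, the negation of the
  strict condition.\<close>

lemma graph_open_ball_eq:
  assumes bij: "bij_betw \<psi> (complete_graph V) {1..}" and G: "G \<in> graphs V"
  shows "graph_open_ball V \<psi> G \<epsilon> = graphs V - graph_closed_ball V \<psi> (complete_graph V - G) (1 - \<epsilon>)"
proof -
  have "graph_norm \<psi> (sym_diff H (complete_graph V - G)) = 1 - graph_norm \<psi> (sym_diff H G)"
    if H: "H \<in> graphs V" for H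
  proof -
    have "sym_diff H (complete_graph V - G) = complete_graph V - sym_diff H G"
      using G H by (auto simp: graphs_def)
    then show ?thesis
      using graph_norm_Diff[OF bij, of "sym_diff H G"] sym_diff_in_graphs[OF H G] by (simp add: graphs_def)
  qed
  then show ?thesis by (auto simp: graph_open_ball_def graph_closed_ball_def)
qed

lemma measure_graph_balls:
  assumes "countable V" and bij: "bij_betw \<psi> (complete_graph V) {1..}" and G: "G \<in> graphs V"
    and "0 \<le> \<epsilon>" "\<epsilon> \<le> 1"
  shows "measure (fair_graph_measure V) (graph_open_ball V \<psi> G \<epsilon>) = \<epsilon>"
    and "measure (fair_graph_measure V) (graph_closed_ball V \<psi> G \<epsilon>) = \<epsilon>"
    and "graph_open_ball V \<psi> G \<epsilon> \<in> sets (graph_borel V)"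
proof -
  let ?M = "fair_graph_measure V"
  let ?G' = "complete_graph V - G"
  interpret prob_space ?M by (rule prob_space_fair_graph_measure) fact
  have G': "?G' \<in> graphs V" by (auto simp: graphs_def)
  have sets: "graph_closed_ball V \<psi> H r \<in> sets ?M" if "H \<in> graphs V" for H r
    using graph_closed_ball_sets[OF bij that] by simp
  show "graph_open_ball V \<psi> G \<epsilon> \<in> sets (graph_borel V)"
    using sets.compl_sets[OF sets[OF G', of "1 - \<epsilon>"]] by (simp add: graph_open_ball_eq[OF bij G])
  \<comment> \<open>Here \<open>\<epsilon> \<le> 1\<close> keeps the radius nonnegative, as the
    upper bound requires. Complementation then starts the chain from \<epsilon> to the open ball, to
    the closed ball, and back to \<epsilon>.\<close>
  have "measure ?M (graph_closed_ball V \<psi> ?G' (1 - \<epsilon>)) \<le> 1 - \<epsilon>"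
    using measure_graph_closed_ball_le[OF assms(1) bij G'] assms(5) by simp
  then have "\<epsilon> \<le> measure ?M (graph_open_ball V \<psi> G \<epsilon>)"
    using prob_compl[OF sets[OF G', of "1 - \<epsilon>"]] by (simp add: graph_open_ball_eq[OF bij G])
  moreover have "measure ?M (graph_open_ball V \<psi> G \<epsilon>) \<le> measure ?M (graph_closed_ball V \<psi> G \<epsilon>)"
    using sets[OF G] by (intro finite_measure_mono) (auto simp: graph_open_ball_def graph_closed_ball_def)
  moreover have "measure ?M (graph_closed_ball V \<psi> G \<epsilon>) \<le> \<epsilon>"
    using measure_graph_closed_ball_le assms by blast
  ultimately show "measure ?M (graph_open_ball V \<psi> G \<epsilon>) = \<epsilon>"
    "measure ?M (graph_closed_ball V \<psi> G \<epsilon>) = \<epsilon>" by auto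
qed

theorem theorem1:
  fixes V :: "'v set"
  assumes "countable V" and "infinite V"
  shows "(\<forall>\<mu>. haar_probability (graph_group V) (graph_topology V) \<mu> \<longleftrightarrow> \<mu> = fair_graph_measure V) \<and>
    (\<forall>\<mu> \<psi> G. \<forall>\<epsilon>::real.
      haar_probability (graph_group V) (graph_topology V) \<mu> \<and>
      bij_betw \<psi> (complete_graph V) {1..} \<and> G \<in> graphs V \<and> 0 \<le> \<epsilon> \<and> \<epsilon> \<le> 1 \<longrightarrow>
        graph_open_ball V \<psi> G \<epsilon> \<in> sets \<mu> \<and>
        emeasure \<mu> (graph_open_ball V \<psi> G \<epsilon>) = ennreal \<epsilon> \<and>
        graph_closed_ball V \<psi> G \<epsilon> \<in> sets \<mu> \<and>
        emeasure \<mu> (graph_closed_ball V \<psi> G \<epsilon>) = ennreal \<epsilon>)"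
proof -
  \<comment> \<open>Every Haar probability measure equals the fair measure, so the claims about
    balls reduce to that one measure.\<close>
  interpret prob_space "fair_graph_measure V" by (rule prob_space_fair_graph_measure) fact
  show ?thesis
    using assms(1)
    by (auto simp: haar_probability_graph_iff emeasure_eq_measure measure_graph_balls graph_closed_ball_sets)
qed

end
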